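(* Let $\alpha\in\mathbb{R}$ with $|\alpha|<1$, and let $\{a_n\}_{n\ge 0}$ be a complex sequence such that, for some $\delta\in[0,\pi/2)$, $$\sum_{n=0}^\infty |a_n|\,e^{-\delta n}<\infty .$$ (i) Let $f(x)=\sum_{n=0}^\infty a_n\,\mathrm{Re}\,K_{\alpha+in}(x)$, $x>0$. Then for every real $u\neq 0$, $$\int_0^\infty e^{-x\cosh u} f(x)\,dx=\frac{\pi}{\sinh u}\sum_{n=0}^\infty \frac{a_n\left[\sinh(\alpha u)\sin(\alpha\pi)\cosh(\pi n)\cos(nu)+\cosh(\alpha u)\cos(\alpha\pi)\sinh(\pi n)\sin(nu)\right]}{\sinh^2(\pi n)+\sin^2(\pi\alpha)},$$ where, when $\alpha=0$, the summand with $n=0$ is understood as its limit $a_0 u/\pi$ as $\alpha\to 0$. (ii) Suppose in addition $a_0=0$, and let $f(x)=\sum_{n=0}^\infty a_n\,\mathrm{Im}\,K_{\alpha+in}(x)$, $x>0$. Then for every real $u\neq 0$, $$\int_0^\infty e^{-x\cosh u} f(x)\,dx=\frac{\pi}{\sinh u}\sum_{n=1}^\infty \frac{a_n\left[\cosh(\alpha u)\sin(\alpha\pi)\cosh(\pi n)\sin(nu)-\sinh(\alpha u)\cos(\alpha\pi)\sinh(\pi n)\cos(nu)\right]}{\sinh^2(\pi n)+\sin^2(\pi\alpha)}.$$ In both (i) and (ii), the series and the integrals converge absolutely.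
   Context: $K_\nu$ denotes the modified Bessel function (Macdonald function), given for $x>0$ and $\nu\in\mathbb{C}$ by $K_\nu(x)=\int_0^\infty e^{-x\cosh t}\cosh(\nu t)\,dt$. For real $\alpha,\tau$ and $x>0$, $$\mathrm{Re}\,K_{\alpha+i\tau}(x)=\int_0^\infty e^{-x\cosh t}\cosh(\alpha t)\cos(\tau t)\,dt,\qquad \mathrm{Im}\,K_{\alpha+i\tau}(x)=\int_0^\infty e^{-x\cosh t}\sinh(\alpha t)\sin(\tau t)\,dt.$$ *)

theory Defs
  imports "HOL-Analysis.Analysis"
begin

text \<open>Real and imaginary parts of the Macdonald function K_{alpha + i tau}(x), x > 0,
  via the integral representations given in the paper.\<close>

definition ReK :: "real \<Rightarrow> real \<Rightarrow> real \<Rightarrow> real" where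
  "ReK \<alpha> \<tau> x = (LBINT t:{0..}. exp (- x * cosh t) * cosh (\<alpha> * t) * cos (\<tau> * t))"

definition ImK :: "real \<Rightarrow> real \<Rightarrow> real \<Rightarrow> real" where
  "ImK \<alpha> \<tau> x = (LBINT t:{0..}. exp (- x * cosh t) * sinh (\<alpha> * t) * sin (\<tau> * t))"

end

theory Submission
  imports Defs "HOL-Complex_Analysis.Complex_Analysis" "HOL-Probability.Sinc_Integral"
    "HOL-Real_Asymp.Real_Asymp"
begin

text \<open>Write \<open>K\<^sub>\<mu>(x)\<close> as half the integral of \<open>exp (\<mu> t - x cosh t)\<close> over the real line, \<open>\<mu> = \<alpha> + \<i> n\<close>.
  Moving the line to \<open>\<real> + \<i> \<delta>\<close> with \<open>\<delta> < \<pi>/2\<close> gives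
  \<open>\<bar>K\<^sub>\<mu>(x)\<bar> \<le> exp (- \<delta> n) K\<^sub>\<alpha>(x cos \<delta>)\<close>, and \<open>exp (- x cosh u) K\<^sub>\<alpha>(x cos \<delta>)\<close> is integrable
  because \<open>\<bar>\<alpha>\<bar> < 1\<close>; hence the series may be integrated term by term. By Fubini the Laplace
  transform of \<open>K\<^sub>\<mu>\<close> at \<open>cosh u\<close> is half the integral of \<open>exp (\<mu> t) / (cosh u + cosh t)\<close>, which the residue
  theorem evaluates to \<open>\<pi> sinh (\<mu> u) / (sinh u sin (\<pi> \<mu>))\<close>; the two claims are its real and
  imaginary parts.\<close>

subsection \<open>The Macdonald function as a full-line integral\<close>

lemma integrable_exp_minus_abs:
  fixes c :: real
  assumes "c > 0"
  shows "integrable lborel (\<lambda>t. exp (- c * \<bar>t\<bar>))"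
proof -
  have pos: "integrable lborel (\<lambda>t. indicator {0<..} t *\<^sub>R exp (- (t * c)))"
    using integrable_I0i_exp_mscale[OF assms] by (simp add: set_integrable_def)
  have neg: "integrable lborel (\<lambda>t. indicator {0<..} (- t) *\<^sub>R exp (- ((- t) * c)))"
    using lborel_integrable_real_affine[OF pos, of "-1" 0] by simp
  have "integrable lborel (\<lambda>t. indicator {0<..} t *\<^sub>R exp (- (t * c))
           + indicator {0<..} (- t) *\<^sub>R exp (- ((- t) * c)))"
    by (rule Bochner_Integration.integrable_add[OF pos neg])
  \<comment> \<open>Both half-lines are open, so the identity fails at \<open>t = 0\<close> and
    holds only almost everywhere.\<close>
  moreover have "AE t in lborel. indicator {0<..} t *\<^sub>R exp (- (t * c))
           + indicator {0<..} (- t) *\<^sub>R exp (- ((- t) * c)) = exp (- c * \<bar>t\<bar>)"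
    using AE_lborel_singleton[of 0]
    by eventually_elim (auto simp: indicator_def abs_if mult.commute)
  ultimately show ?thesis
    by (subst integrable_cong_AE[symmetric, rotated 2]) auto
qed

lemma cosh_of_real_complex: "cosh (complex_of_real t) = of_real (cosh t)"
  by (simp add: cosh_field_def exp_of_real[symmetric])

lemma exp_abs_le_cosh: "exp \<bar>t\<bar> / 2 \<le> cosh (t::real)"
  by (subst cosh_real_abs[symmetric]) (simp add: cosh_field_def del: cosh_real_abs)

lemma mult_le_mult_abs:
  fixes a t c :: real
  assumes "\<bar>a\<bar> \<le> c"
  shows "a * t \<le> c * \<bar>t\<bar>"
proof -
  have "a * t \<le> \<bar>a\<bar> * \<bar>t\<bar>" using abs_ge_self[of "a * t"] by (simp add: abs_mult)
  also have "\<dots> \<le> c * \<bar>t\<bar>" using assms by (intro mult_right_mono) auto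
  finally show ?thesis .
qed

text \<open>The Taylor bound \<open>cosh t \<ge> t^2 / 4\<close> beats any linear term and leaves an
  exponent that falls like \<open>- |t|\<close>.\<close>

lemma integrable_exp_minus_cosh:
  fixes a x :: real
  assumes "x > 0"
  shows "integrable lborel (\<lambda>t. exp (a * t - x * cosh t))"
proof -
  \<comment> \<open>\<open>C\<close> is the maximum over \<open>s \<ge> 0\<close> of
    \<open>(|a| + 1) s - x s^2 / 4\<close>; the extra 1 in the slope is what leaves
    \<open>- |t|\<close> in the exponent.\<close>
  define C where "C = (\<bar>a\<bar> + 1)\<^sup>2 / x"
  have "a * t - x * cosh t \<le> C - \<bar>t\<bar>" for t
  proof -
    have "1 + \<bar>t\<bar> + \<bar>t\<bar>\<^sup>2 / 2 \<le> exp \<bar>t\<bar>"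
      by (rule exp_lower_Taylor_quadratic) auto
    hence "\<bar>t\<bar>\<^sup>2 / 4 \<le> cosh t"
      using exp_abs_le_cosh[of t] by linarith
    hence "x * (\<bar>t\<bar>\<^sup>2 / 4) \<le> x * cosh t"
      using assms by (intro mult_left_mono) auto
    moreover have "(\<bar>a\<bar> + 1) * \<bar>t\<bar> \<le> C + x * (\<bar>t\<bar>\<^sup>2 / 4)"
    proof -
      have "0 \<le> ((\<bar>a\<bar> + 1) - x * \<bar>t\<bar> / 2)\<^sup>2 / x"
        using assms by simp
      also have "\<dots> = C + x * (\<bar>t\<bar>\<^sup>2 / 4) - (\<bar>a\<bar> + 1) * \<bar>t\<bar>"
        using assms unfolding C_def by (simp add: field_simps power2_eq_square)
      finally show ?thesis by simp
    qed
    moreover have "a * t \<le> \<bar>a\<bar> * \<bar>t\<bar>"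
      by (rule mult_le_mult_abs) simp
    ultimately show ?thesis by (simp add: algebra_simps)
  qed
  hence *: "exp (a * t - x * cosh t) \<le> exp C * exp (- 1 * \<bar>t\<bar>)" for t
    by (simp add: exp_add [symmetric])
  show ?thesis
    by (rule Bochner_Integration.integrable_bound[OF integrable_mult_right[OF integrable_exp_minus_abs[of 1], of "exp C"]])
       (use * in \<open>auto intro!: borel_measurable_continuous_onI continuous_intros\<close>)
qed

text \<open>The full-line exponential form of \<open>K\<close>: unlike the half-line integrals of \<open>ReK\<close> and
  \<open>ImK\<close>, its path of integration can be moved to \<open>\<real> + \<i> \<delta>\<close>.\<close>

definition MK :: "complex \<Rightarrow> real \<Rightarrow> complex" where
  "MK \<mu> x = (LBINT t. exp (\<mu> * of_real t - of_real (x * cosh t))) / 2"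

lemma integrable_MK_kernel:
  fixes \<mu> :: complex
  assumes "x > 0"
  shows "integrable lborel (\<lambda>t. exp (\<mu> * of_real t - of_real (x * cosh t)))"
proof (rule Bochner_Integration.integrable_bound[OF integrable_exp_minus_cosh[OF assms, of "Re \<mu>"]])
  show "AE t in lborel. norm (exp (\<mu> * of_real t - of_real (x * cosh t)))
          \<le> norm (exp (Re \<mu> * t - x * cosh t))"
    by simp
qed (auto intro!: borel_measurable_continuous_onI continuous_intros)

text \<open>Needed to pass from the full line of \<open>MK\<close> to the half-line on which
  \<open>ReK\<close> and \<open>ImK\<close> are defined.\<close>

lemma lborel_integral_symmetrize:
  fixes g :: "real \<Rightarrow> complex"
  assumes "integrable lborel g"
  shows "integral\<^sup>L lborel g = (LBINT t:{0..}. g t + g (- t))"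
proof -
  have refl: "integrable lborel (\<lambda>t. g (- t))"
    using lborel_integrable_real_affine[OF assms, of "-1" 0] by simp
  have set_int: "set_integrable lborel S h" if "integrable lborel h" "S \<in> sets borel"
    for S and h :: "real \<Rightarrow> complex"
    using that unfolding set_integrable_def by (intro integrable_mult_indicator) auto
  have "integral\<^sup>L lborel g = (LBINT t:{0..} \<union> {..<0}. g t)"
    by (simp add: set_lebesgue_integral_def ivl_disj_un)
       (auto intro!: Bochner_Integration.integral_cong simp: indicator_def)
  also have "\<dots> = (LBINT t:{0..}. g t) + (LBINT t:{..<0}. g t)"
    by (intro set_integral_Un set_int assms) auto
  also have "(LBINT t:{..<0}. g t) = (LBINT t:{0<..}. g (- t))"
    by (subst set_integral_reflect) (simp add: greaterThan_def)
  also have "\<dots> = (LBINT t:{0..}. g (- t))"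
    unfolding set_lebesgue_integral_def
    using AE_lborel_singleton[of 0]
    by (intro integral_cong_AE)
       (use assms refl in \<open>auto simp: indicator_def elim!: eventually_mono\<close>)
  finally show ?thesis
    by (subst set_integral_add(2)) (auto intro!: set_int assms refl)
qed

text \<open>Folding the line turns \<open>exp (\<mu> t)\<close> into
  \<open>2 cosh (\<mu> t)\<close>, and the real and imaginary parts of
  \<open>cosh ((\<alpha> + \<i> \<tau>) t)\<close> are the factors in \<open>ReK\<close> and
  \<open>ImK\<close>.\<close>

lemma
  assumes "x > 0"
  shows Re_MK: "Re (MK (Complex \<alpha> \<tau>) x) = ReK \<alpha> \<tau> x"
    and Im_MK: "Im (MK (Complex \<alpha> \<tau>) x) = ImK \<alpha> \<tau> x"
proof -
  let ?g = "\<lambda>t. exp (Complex \<alpha> \<tau> * of_real t - of_real (x * cosh t))"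
  let ?h = "\<lambda>t. complex_of_real (exp (- x * cosh t)) *
     Complex (cosh (\<alpha> * t) * cos (\<tau> * t)) (sinh (\<alpha> * t) * sin (\<tau> * t))"
  have eq: "(?g t + ?g (- t)) / 2 = ?h t" for t
  proof -
    have kernel: "?g s = complex_of_real (exp (- x * cosh s)) *
        Complex (exp (\<alpha> * s) * cos (\<tau> * s)) (exp (\<alpha> * s) * sin (\<tau> * s))" for s
      by (simp add: complex_eq_iff Re_exp Im_exp exp_diff exp_minus divide_inverse)
    show ?thesis
      unfolding kernel
      by (simp add: complex_eq_iff cosh_field_def[of "\<alpha> * t"] sinh_field_def[of "\<alpha> * t"] algebra_simps
          add_divide_distrib diff_divide_distrib)
  qed
  \<comment> \<open>Taking the real or imaginary part under the integral sign requires the complex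
    integrand to be integrable.\<close>
  have int: "set_integrable lborel {0..} ?h"
    unfolding eq[symmetric] set_integrable_def
    using integrable_MK_kernel[OF assms, of "Complex \<alpha> \<tau>"]
      lborel_integrable_real_affine[OF integrable_MK_kernel[OF assms, of "Complex \<alpha> \<tau>"], of "-1" 0]
    by (intro integrable_mult_indicator integrable_divide_zero Bochner_Integration.integrable_add) auto
  have MK: "MK (Complex \<alpha> \<tau>) x = (LBINT t:{0..}. ?h t)"
    unfolding MK_def lborel_integral_symmetrize[OF integrable_MK_kernel[OF assms]]
    by (subst set_integral_divide_zero[symmetric]) (simp only: eq)
  show "Re (MK (Complex \<alpha> \<tau>) x) = ReK \<alpha> \<tau> x"
    unfolding MK ReK_def set_lebesgue_integral_def
    by (subst integral_Re[symmetric, OF int[unfolded set_integrable_def]])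
       (simp add: mult.assoc)
  show "Im (MK (Complex \<alpha> \<tau>) x) = ImK \<alpha> \<tau> x"
    unfolding MK ImK_def set_lebesgue_integral_def
    by (subst integral_Im[symmetric, OF int[unfolded set_integrable_def]])
       (simp add: mult.assoc)
qed

subsection \<open>Moving the line of integration\<close>

lemma horizontal_contour_integral:
  fixes f :: "complex \<Rightarrow> complex"
  assumes "R > 0" and cont: "continuous_on UNIV (\<lambda>t. f (Complex t y))"
  shows "(f has_contour_integral (LBINT t:{-R..R}. f (Complex t y))) (linepath (Complex (- R) y) (Complex R y))"
proof -
  have "set_integrable lborel {-R..R} (\<lambda>t. f (Complex t y))"
    by (intro borel_integrable_atLeastAtMost' continuous_on_subset[OF cont]) auto
  hence "((\<lambda>t. f (Complex t y)) has_integral (LBINT t:{-R..R}. f (Complex t y))) {-R..R}"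
    by (metis set_borel_integral_eq_integral integrable_integral)
  \<comment> \<open>Translation by \<open>\<i> y\<close> puts the segment on the real axis, where a
    contour integral is an ordinary one. The translation back is harmless: only the values along the
    segment and the difference of its endpoints matter.\<close>
  hence "((\<lambda>t. (\<lambda>z. f (z + Complex 0 y)) (of_real t)) has_integral (LBINT t:{-R..R}. f (Complex t y))) {-R..R}"
    by (simp add: complex_of_real_def complex_add)
  hence "((\<lambda>z. f (z + Complex 0 y)) has_contour_integral (LBINT t:{-R..R}. f (Complex t y)))
          (linepath (of_real (- R)) (of_real R))"
    using assms by (subst has_contour_integral_linepath_Reals_iff) auto
  moreover have "linepath (of_real (- R)) (of_real R) x + Complex 0 y =
      linepath (Complex (- R) y) (Complex R y) x" for x
    by (simp add: linepath_def complex_eq_iff algebra_simps)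
  moreover have "complex_of_real R - complex_of_real (- R) = Complex R y - Complex (- R) y"
    by (simp add: complex_eq_iff)
  ultimately show ?thesis
    by (simp add: has_contour_integral_linepath)
qed

lemma truncated_integral_tendsto:
  fixes g :: "real \<Rightarrow> complex"
  assumes "integrable lborel g"
  shows "((\<lambda>R. LBINT t:{-R..R}. g t) \<longlongrightarrow> integral\<^sup>L lborel g) at_top"
  unfolding set_lebesgue_integral_def
proof (rule integral_dominated_convergence_at_top[where w = "\<lambda>t. norm (g t)"])
  show "AE x in lborel. ((\<lambda>R. indicator {-R..R} x *\<^sub>R g x) \<longlongrightarrow> g x) at_top"
  proof (rule AE_I2)
    fix x :: real
    show "((\<lambda>R. indicator {-R..R} x *\<^sub>R g x) \<longlongrightarrow> g x) at_top"
      by (intro tendsto_eventually eventually_mono[OF eventually_ge_at_top[of "\<bar>x\<bar>"]])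
         (auto simp: indicator_def)
  qed
qed (use assms in \<open>auto simp: indicator_def intro!: always_eventually\<close>)

text \<open>The side keeps its length \<open>h\<close> while the bound \<open>G R\<close> tends to
  0. The sign \<open>s\<close> selects the right or the left side; asking for continuity only at
  large \<open>R\<close> allows poles of \<open>f\<close> in the strip.\<close>

lemma vertical_contour_integral_tendsto_0:
  fixes f :: "complex \<Rightarrow> complex"
  assumes "h > 0" and s: "s \<in> {-1, 1}"
    and cont: "\<forall>\<^sub>F R in at_top. continuous_on {z. \<bar>Re z\<bar> = R \<and> Im z \<in> {0..h}} f"
    and bound: "\<forall>\<^sub>F R in at_top. \<forall>z. \<bar>Re z\<bar> = R \<longrightarrow> Im z \<in> {0..h} \<longrightarrow> norm (f z) \<le> G R"
    and G: "(G \<longlongrightarrow> 0) at_top"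
  shows "((\<lambda>R. contour_integral (linepath (Complex (s * R) 0) (Complex (s * R) h)) f) \<longlongrightarrow> 0) at_top"
proof (rule Lim_null_comparison)
  show "((\<lambda>R. G R * h) \<longlongrightarrow> 0) at_top"
    using tendsto_mult_right[OF G, of h] by simp
  show "\<forall>\<^sub>F R in at_top. norm (contour_integral (linepath (Complex (s * R) 0) (Complex (s * R) h)) f) \<le> G R * h"
    using cont bound eventually_gt_at_top[of 0]
  proof eventually_elim
    case (elim R)
    have seg: "closed_segment (Complex (s * R) 0) (Complex (s * R) h) \<subseteq> {z. \<bar>Re z\<bar> = R \<and> Im z \<in> {0..h}}"
      using s \<open>h > 0\<close> elim(3) by (subst closed_segment_same_Re) (auto simp: closed_segment_eq_real_ivl)
    have "norm (contour_integral (linepath (Complex (s * R) 0) (Complex (s * R) h)) f)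
            \<le> G R * norm (Complex (s * R) h - Complex (s * R) 0)"
    proof (rule contour_integral_bound_linepath)
      show "f contour_integrable_on linepath (Complex (s * R) 0) (Complex (s * R) h)"
        by (intro contour_integrable_continuous_linepath continuous_on_subset[OF elim(1) seg])
      show "norm (f z) \<le> G R" if "z \<in> closed_segment (Complex (s * R) 0) (Complex (s * R) h)" for z
        using elim(2) seg that by blast
      \<comment> \<open>\<open>G R\<close> is nonnegative because it bounds a norm at some
        point.\<close>
      have "norm (f (Complex R 0)) \<le> G R"
        using elim(2,3) \<open>h > 0\<close> by auto
      thus "0 \<le> G R" using norm_ge_zero order_trans by blast
    qed
    also have "Complex (s * R) h - Complex (s * R) 0 = Complex 0 h"
      by (simp add: complex_eq_iff)
    also have "norm (Complex 0 h) = h" using \<open>h > 0\<close> by (simp add: cmod_def)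
    finally show ?case .
  qed
qed

text \<open>The constant \<open>c\<close> is \<open>0\<close> for the shift of the Macdonald integral and \<open>2 \<pi> \<i>\<close> times the sum of the
  residues for the evaluation of the Laplace transform.\<close>

lemma integral_strip_difference:
  fixes f :: "complex \<Rightarrow> complex"
  assumes h: "h > 0"
    and rect: "\<forall>\<^sub>F R in at_top. contour_integral (rectpath (Complex (- R) 0) (Complex R h)) f = c"
    and bottom: "continuous_on UNIV (\<lambda>t. f (Complex t 0))" "integrable lborel (\<lambda>t. f (Complex t 0))"
    and top: "continuous_on UNIV (\<lambda>t. f (Complex t h))" "integrable lborel (\<lambda>t. f (Complex t h))"
    and cont: "\<forall>\<^sub>F R in at_top. continuous_on {z. \<bar>Re z\<bar> = R \<and> Im z \<in> {0..h}} f"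
    and bound: "\<forall>\<^sub>F R in at_top. \<forall>z. \<bar>Re z\<bar> = R \<longrightarrow> Im z \<in> {0..h} \<longrightarrow> norm (f z) \<le> G R"
    and G: "(G \<longlongrightarrow> 0) at_top"
  shows "(LBINT t. f (Complex t 0)) - (LBINT t. f (Complex t h)) = c"
proof -
  let ?V = "\<lambda>s R. contour_integral (linepath (Complex (s * R) 0) (Complex (s * R) h)) f"
  let ?H = "\<lambda>y R. LBINT t:{-R..R}. f (Complex t y)"
  have "((\<lambda>R. ?H 0 R + ?V 1 R - ?H h R - ?V (-1) R) \<longlongrightarrow>
      (LBINT t. f (Complex t 0)) + 0 - (LBINT t. f (Complex t h)) - 0) at_top"
    by (intro tendsto_intros truncated_integral_tendsto vertical_contour_integral_tendsto_0[OF h _ cont bound G]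
        bottom top) auto
  moreover have "\<forall>\<^sub>F R in at_top. ?H 0 R + ?V 1 R - ?H h R - ?V (-1) R = c"
    using rect cont eventually_gt_at_top[of 0]
  proof eventually_elim
    case (elim R)
    let ?a = "Complex (- R) 0" and ?b = "Complex R 0" and ?c = "Complex R h" and ?d = "Complex (- R) h"
    have seg: "closed_segment (Complex (s * R) 0) (Complex (s * R) h) \<subseteq> {z. \<bar>Re z\<bar> = R \<and> Im z \<in> {0..h}}"
      if "s \<in> {-1, 1}" for s
      using h elim(3) that by (subst closed_segment_same_Re) (auto simp: closed_segment_eq_real_ivl)
    have V: "(f has_contour_integral ?V s R) (linepath (Complex (s * R) 0) (Complex (s * R) h))"
      if "s \<in> {-1, 1}" for s
      by (intro has_contour_integral_integral contour_integrable_continuous_linepath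
          continuous_on_subset[OF elim(2) seg] that)
    \<comment> \<open>The rectangle is traversed counterclockwise, so the top and left sides run
      against the directions used in \<open>?H h\<close> and \<open>?V (-1)\<close>.\<close>
    have "(f has_contour_integral (?H 0 R + (?V 1 R + (- ?H h R + - ?V (-1) R))))
        (linepath ?a ?b +++ linepath ?b ?c +++ linepath ?c ?d +++ linepath ?d ?a)"
      using V[of 1] has_contour_integral_reverse_linepath[OF V[of "-1"]]
        has_contour_integral_reverse_linepath[OF horizontal_contour_integral[OF elim(3) top(1)]]
        horizontal_contour_integral[OF elim(3) bottom(1)]
      by (intro has_contour_integral_join valid_path_join) auto
    hence "contour_integral (rectpath ?a ?c) f = ?H 0 R + (?V 1 R + (- ?H h R + - ?V (-1) R))"
      by (simp add: rectpath_def Let_def contour_integral_unique)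
    thus ?case using elim(1) by simp
  qed
  hence "((\<lambda>R. ?H 0 R + ?V 1 R - ?H h R - ?V (-1) R) \<longlongrightarrow> c) at_top"
    by (rule tendsto_eventually)
  ultimately show ?thesis
    using tendsto_unique[OF trivial_limit_at_top_linorder] by fastforce
qed

lemma
  shows Re_cosh_Complex: "Re (cosh (Complex t s)) = cosh t * cos s"
    and Im_cosh_Complex: "Im (cosh (Complex t s)) = sinh t * sin s"
  by (simp_all add: cosh_field_def sinh_field_def Re_exp Im_exp algebra_simps add_divide_distrib diff_divide_distrib)

text \<open>The integrand is entire, and between the two lines its decay survives because
  \<open>Re (cosh (t + \<i> s)) = cosh t cos s\<close> with
  \<open>cos s \<ge> cos \<delta> > 0\<close>; this is where \<open>\<delta> < \<pi>/2\<close>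
  enters.\<close>

lemma MK_shift:
  fixes \<mu> :: complex
  assumes x: "x > 0" and \<delta>: "0 < \<delta>" "\<delta> < pi / 2"
  shows "MK \<mu> x = (LBINT t. exp (\<mu> * Complex t \<delta> - of_real x * cosh (Complex t \<delta>))) / 2"
proof -
  define f where "f = (\<lambda>z. exp (\<mu> * z - of_real x * cosh z))"
  have hol: "f holomorphic_on S" for S
    unfolding f_def cosh_field_def by (intro holomorphic_intros) auto
  have contf: "continuous_on S f" for S
    using hol holomorphic_on_imp_continuous_on by blast
  have contl: "continuous_on UNIV (\<lambda>t. f (Complex t y))" for y
    unfolding Complex_eq by (intro continuous_on_compose2[OF contf[of UNIV]] continuous_intros) auto
  have normf: "norm (f (Complex t s)) = exp (Re \<mu> * t - Im \<mu> * s - x * (cosh t * cos s))" for t s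
    by (simp add: f_def Re_cosh_Complex)
  have cos: "cos \<delta> > 0" "s \<in> {0..\<delta>} \<Longrightarrow> cos \<delta> \<le> cos s" for s
    using \<delta> by (auto intro!: cos_gt_zero_pi cos_monotone_0_pi_le)
  \<comment> \<open>One bound for both vertical sides; the term
    \<open>- x cosh R cos \<delta>\<close> outweighs the linear growth in \<open>R\<close>.\<close>
  define G where "G = (\<lambda>R. exp (\<bar>Re \<mu>\<bar> * R + \<bar>Im \<mu>\<bar> * \<delta> - x * (cosh R * cos \<delta>)))"
  have bound: "norm (f z) \<le> G R" if "\<bar>Re z\<bar> = R" "Im z \<in> {0..\<delta>}" for z R
  proof -
    have "Re \<mu> * Re z \<le> \<bar>Re \<mu>\<bar> * R"
      using mult_le_mult_abs[of "Re \<mu>" "\<bar>Re \<mu>\<bar>" "Re z"] that by simp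
    moreover have "- (Im \<mu> * Im z) \<le> \<bar>Im \<mu>\<bar> * \<delta>"
    proof -
      have "- (Im \<mu> * Im z) \<le> \<bar>Im \<mu>\<bar> * \<bar>Im z\<bar>"
        using mult_le_mult_abs[of "- Im \<mu>" "\<bar>Im \<mu>\<bar>" "Im z"] by simp
      also have "\<dots> \<le> \<bar>Im \<mu>\<bar> * \<delta>" using that by (intro mult_left_mono) auto
      finally show ?thesis .
    qed
    moreover have cosh: "cosh (Re z) = cosh R" using that(1) cosh_real_abs by metis
    moreover have "x * (cosh R * cos \<delta>) \<le> x * (cosh R * cos (Im z))"
      using x cos that by (intro mult_left_mono) auto
    ultimately have "exp (Re \<mu> * Re z - Im \<mu> * Im z - x * (cosh (Re z) * cos (Im z))) \<le> G R"
      unfolding G_def exp_le_cancel_iff cosh by linarith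
    thus ?thesis using normf[of "Re z" "Im z"] by simp
  qed
  have G: "(G \<longlongrightarrow> 0) at_top"
  proof -
    define k where "k = x * cos \<delta>"
    have "k > 0" using x cos by (simp add: k_def)
    have "((\<lambda>R. exp (\<bar>Re \<mu>\<bar> * R + \<bar>Im \<mu>\<bar> * \<delta> - k * ((exp R + exp (- R)) / 2))) \<longlongrightarrow> 0) at_top"
      using \<open>k > 0\<close> by real_asymp
    also have "(\<lambda>R. exp (\<bar>Re \<mu>\<bar> * R + \<bar>Im \<mu>\<bar> * \<delta> - k * ((exp R + exp (- R)) / 2))) = G"
      unfolding G_def k_def cosh_field_def by (simp add: mult_ac)
    finally show ?thesis .
  qed
  have bottom: "integrable lborel (\<lambda>t. f (Complex t 0))"
    using integrable_MK_kernel[OF x, of \<mu>]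
    by (simp add: f_def complex_of_real_def[symmetric] cosh_of_real_complex)
  have top: "integrable lborel (\<lambda>t. f (Complex t \<delta>))"
  proof (rule Bochner_Integration.integrable_bound)
    show "integrable lborel (\<lambda>t. exp (- Im \<mu> * \<delta>) * exp (Re \<mu> * t - (x * cos \<delta>) * cosh t))"
      using x cos by (intro integrable_mult_right integrable_exp_minus_cosh) auto
    show "(\<lambda>t. f (Complex t \<delta>)) \<in> borel_measurable lborel"
      using contl by (auto intro!: borel_measurable_continuous_onI)
    show "AE t in lborel. norm (f (Complex t \<delta>))
        \<le> norm (exp (- Im \<mu> * \<delta>) * exp (Re \<mu> * t - (x * cos \<delta>) * cosh t))"
      by (simp add: normf exp_add[symmetric] algebra_simps)
  qed
  have "(LBINT t. f (Complex t 0)) - (LBINT t. f (Complex t \<delta>)) = 0"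
  proof (rule integral_strip_difference[OF \<delta>(1) _ contl bottom contl top _ _ G])
    show "\<forall>\<^sub>F R in at_top. contour_integral (rectpath (Complex (- R) 0) (Complex R \<delta>)) f = 0"
      by (intro always_eventually allI contour_integral_unique Cauchy_theorem_convex_simple[OF hol[of UNIV]]) auto
  qed (use bound contf in \<open>auto intro!: always_eventually\<close>)
  moreover have "f (Complex t 0) = exp (\<mu> * of_real t - of_real (x * cosh t))" for t
    by (simp add: f_def complex_of_real_def[symmetric] cosh_of_real_complex)
  ultimately show ?thesis
    by (simp add: MK_def f_def)
qed

text \<open>For a real order the kernel is positive, so nothing is lost in the norm. This lets the
  dominating integral be expressed through \<open>MK\<close> itself.\<close>

lemma norm_MK_of_real:
  "norm (MK (of_real \<alpha>) x) = (LBINT t. exp (\<alpha> * t - x * cosh t)) / 2"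
proof -
  have "MK (of_real \<alpha>) x = (LBINT t. complex_of_real (exp (\<alpha> * t - x * cosh t))) / 2"
    unfolding MK_def by (simp only: of_real_mult[symmetric] of_real_diff[symmetric] exp_of_real)
  also have "\<dots> = of_real ((LBINT t. exp (\<alpha> * t - x * cosh t)) / 2)"
    by (simp only: integral_complex_of_real) simp
  finally show ?thesis
    by (simp only: norm_of_real) (simp add: integral_nonneg_AE)
qed

text \<open>On the shifted line the modulus of the kernel splits off the constant
  \<open>exp (- \<delta> Im \<mu>)\<close> and leaves the kernel of real order at
  \<open>x cos \<delta>\<close>. This exponential factor is what compensates the growth allowed to
  the coefficients.\<close>

lemma norm_MK_le:
  assumes x: "x > 0" and \<delta>: "0 < \<delta>" "\<delta> < pi / 2"
  shows "norm (MK \<mu> x) \<le> exp (- \<delta> * Im \<mu>) * norm (MK (of_real (Re \<mu>)) (cos \<delta> * x))"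
proof -
  have eq: "norm (exp (\<mu> * Complex t \<delta> - of_real x * cosh (Complex t \<delta>)))
      = exp (- \<delta> * Im \<mu>) * exp (Re \<mu> * t - (cos \<delta> * x) * cosh t)" for t
    by (simp add: Re_cosh_Complex exp_add[symmetric] algebra_simps)
  have "norm (MK \<mu> x) \<le> (LBINT t. norm (exp (\<mu> * Complex t \<delta> - of_real x * cosh (Complex t \<delta>)))) / 2"
    unfolding MK_shift[OF assms] by (simp add: norm_divide integral_norm_bound del: norm_exp_eq_Re)
  thus ?thesis
    unfolding eq by (simp add: norm_MK_of_real)
qed

section \<open>The Laplace transform of the Macdonald function by Fubini\<close>

lemma integrable_exp_over_cosh:
  fixes \<mu> :: complex
  assumes "p > 0" "q > 0" "\<bar>Re \<mu>\<bar> < 1"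
  shows "integrable lborel (\<lambda>t. exp (\<mu> * of_real t) / of_real (p + q * cosh t))"
proof (rule Bochner_Integration.integrable_bound)
  \<comment> \<open>The denominator is at least \<open>q exp |t| / 2\<close>, against a numerator of
    size at most \<open>exp (|Re \<mu>| |t|)\<close>; the remaining rate
    \<open>1 - |Re \<mu>|\<close> is positive.\<close>
  show "integrable lborel (\<lambda>t. 2 / q * exp (- (1 - \<bar>Re \<mu>\<bar>) * \<bar>t\<bar>))"
    using assms by (intro integrable_mult_right integrable_exp_minus_abs) auto
  have pos: "p + q * cosh t > 0" for t
    using assms by (intro add_pos_pos mult_pos_pos) auto
  show "(\<lambda>t. exp (\<mu> * of_real t) / of_real (p + q * cosh t)) \<in> borel_measurable lborel"
    using pos less_imp_neq[OF pos]
    by (auto intro!: borel_measurable_continuous_onI continuous_intros simp del: of_real_add)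
  show "AE t in lborel. norm (exp (\<mu> * of_real t) / of_real (p + q * cosh t))
      \<le> norm (2 / q * exp (- (1 - \<bar>Re \<mu>\<bar>) * \<bar>t\<bar>))"
  proof (rule AE_I2)
    fix t :: real
    have "norm (exp (\<mu> * of_real t) / of_real (p + q * cosh t)) = exp (Re \<mu> * t) / (p + q * cosh t)"
      using pos[of t] by (simp add: norm_divide del: of_real_add)
    also have "\<dots> \<le> exp (\<bar>Re \<mu>\<bar> * \<bar>t\<bar>) / (q * (exp \<bar>t\<bar> / 2))"
    proof (rule frac_le)
      show "exp (Re \<mu> * t) \<le> exp (\<bar>Re \<mu>\<bar> * \<bar>t\<bar>)"
        using mult_le_mult_abs[of "Re \<mu>" "\<bar>Re \<mu>\<bar>" t] by simp
      show "q * (exp \<bar>t\<bar> / 2) \<le> p + q * cosh t"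
        using assms mult_left_mono[OF exp_abs_le_cosh[of t], of q] by linarith
    qed (use assms in auto)
    also have "\<dots> = 2 / q * exp (- (1 - \<bar>Re \<mu>\<bar>) * \<bar>t\<bar>)"
      using assms by (simp add: field_simps exp_diff exp_minus)
    finally show "norm (exp (\<mu> * of_real t) / of_real (p + q * cosh t))
      \<le> norm (2 / q * exp (- (1 - \<bar>Re \<mu>\<bar>) * \<bar>t\<bar>))"
      using assms by simp
  qed
qed

text \<open>The scale \<open>q\<close> serves two uses: \<open>q = 1\<close> gives the transform to
  be evaluated, and \<open>q = cos \<delta>\<close> makes the function dominating the series
  integrable.\<close>

lemma
  fixes \<mu> :: complex
  assumes p: "p > 0" and q: "q > 0" and \<mu>: "\<bar>Re \<mu>\<bar> < 1"
  shows integrable_laplace_MK: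
      "set_integrable lborel {0<..} (\<lambda>x. exp (- x * p) *\<^sub>R MK \<mu> (q * x))" (is ?A)
    and laplace_MK:
      "(LBINT x:{0<..}. exp (- x * p) *\<^sub>R MK \<mu> (q * x))
         = (LBINT t. exp (\<mu> * of_real t) / of_real (p + q * cosh t)) / 2" (is ?B)
proof -
  define c where "c = (\<lambda>t. p + q * cosh t)"
  have c: "c t > 0" for t
    unfolding c_def using p q by (intro add_pos_pos mult_pos_pos) auto
  \<comment> \<open>Integrating \<open>F\<close> over \<open>x\<close> first gives the quotient with
    denominator \<open>c t\<close>; integrating over \<open>t\<close> first gives twice the
    integrand of the Laplace transform.\<close>
  define F where "F = (\<lambda>(t, x). (indicator {0<..} x * exp (- (x * c t))) *\<^sub>R exp (\<mu> * of_real t))"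
  have exp_int: "integrable lborel (\<lambda>x. indicator {0<..} x * exp (- (x * c t)))" for t
    using integrable_I0i_exp_mscale[OF c] by (simp add: set_integrable_def)
  have exp_val: "(LBINT x. indicator {0<..} x * exp (- (x * c t))) = 1 / c t" for t
    using LBINT_I0i_exp_mscale[OF c]
    by (simp add: interval_lebesgue_integral_0_infty set_lebesgue_integral_def)
  have meas: "F \<in> borel_measurable (lborel \<Otimes>\<^sub>M lborel)"
  proof -
    have [measurable]: "c \<in> borel_measurable borel" "(\<lambda>t. exp (\<mu> * complex_of_real t)) \<in> borel_measurable borel"
      unfolding c_def by (auto intro!: borel_measurable_continuous_onI continuous_intros)
    show ?thesis unfolding F_def by measurable
  qed
  have normF: "norm (F (t, x)) = (indicator {0<..} x * exp (- (x * c t))) * norm (exp (\<mu> * of_real t))" for t x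
    by (simp add: F_def)
  have F: "integrable (lborel \<Otimes>\<^sub>M lborel) F"
  proof (rule lborel_pair.Fubini_integrable[OF meas])
    \<comment> \<open>The inner integral of the norm is the norm of the quotient, so absolute
      integrability over the product reduces to the preceding lemma.\<close>
    have "(LBINT x. norm (F (t, x))) = norm (exp (\<mu> * of_real t) / of_real (p + q * cosh t))" for t
      unfolding normF integral_mult_left_zero exp_val using c[of t]
      by (simp add: norm_divide c_def del: of_real_add norm_exp_eq_Re)
    thus "integrable lborel (\<lambda>t. LBINT x. norm (F (t, x)))"
      using integrable_norm[OF integrable_exp_over_cosh[OF assms]] by simp
    show "AE t in lborel. integrable lborel (\<lambda>x. F (t, x))"
      unfolding F_def using exp_int by (auto intro!: integrable_scaleR_left)
  qed
  have inner: "(LBINT t. F (t, x)) / 2 = indicator {0<..} x *\<^sub>R (exp (- x * p) *\<^sub>R MK \<mu> (q * x))" for x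
  proof (cases "x > 0")
    case True
    have "F (t, x) = exp (- x * p) *\<^sub>R exp (\<mu> * of_real t - of_real (q * x * cosh t))" for t
      using True by (simp add: F_def c_def scaleR_conv_of_real exp_diff exp_add exp_minus algebra_simps
          exp_of_real[symmetric] divide_inverse)
    thus ?thesis using True by (simp add: MK_def)
  qed (simp add: F_def)
  have "integrable lborel (\<lambda>x. (LBINT t. F (t, x)) / 2)"
    using lborel_pair.integrable_snd[of "\<lambda>t x. F (t, x)"] F
    by (intro integrable_divide_zero) (auto simp: case_prod_eta)
  thus ?A by (simp add: inner set_integrable_def)
  have "(LBINT x:{0<..}. exp (- x * p) *\<^sub>R MK \<mu> (q * x)) = (LBINT x. (LBINT t. F (t, x)) / 2)"
    by (simp add: inner set_lebesgue_integral_def)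
  also have "\<dots> = (LBINT x. LBINT t. F (t, x)) / 2" by simp
  also have "(LBINT x. LBINT t. F (t, x)) = (LBINT t. LBINT x. F (t, x))"
    using lborel_pair.Fubini_integral[of "\<lambda>t x. F (t, x)"] F by (simp add: case_prod_eta)
  also have "(LBINT t. LBINT x. F (t, x)) = (LBINT t. exp (\<mu> * of_real t) / of_real (p + q * cosh t))"
  proof (rule Bochner_Integration.integral_cong[OF refl])
    fix t
    show "(LBINT x. F (t, x)) = exp (\<mu> * of_real t) / of_real (p + q * cosh t)"
      unfolding F_def prod.case
      by (subst integral_scaleR_left) (simp_all add: exp_int exp_val, simp add: c_def scaleR_conv_of_real divide_inverse mult.commute)
  qed
  finally show ?B .
qed

subsection \<open>Evaluation of the Laplace transform\<close>

lemma sinh_Complex_pi: "sinh (Complex v pi) = - of_real (sinh v)"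
  by (simp add: sinh_field_def complex_eq_iff Re_exp Im_exp algebra_simps add_divide_distrib diff_divide_distrib)

text \<open>With \<open>cosh z = cos (\<i> z)\<close> the equation becomes
  \<open>cos (\<i> z) = cos (\<i> u + \<pi>)\<close>, solved by
  \<open>\<i> z = \<plusminus> (\<i> u + \<pi>)\<close> modulo \<open>2 \<pi>\<close>. The open
  strip stops short of the neighbouring zeros at heights \<open>- \<pi>\<close> and
  \<open>3 \<pi>\<close>, so each sign admits a single integer.\<close>

lemma cosh_eq_minus_cosh_strip:
  fixes z :: complex and u :: real
  assumes "- pi < Im z" "Im z < 3 * pi"
  shows "of_real (cosh u) + cosh z = 0 \<longleftrightarrow> z \<in> {Complex u pi, Complex (- u) pi}"
proof
  assume "of_real (cosh u) + cosh z = 0"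
  hence "cosh z = - cosh (of_real u)"
    by (simp only: cosh_of_real_complex add_eq_0_iff)
  hence "cos (\<i> * z) = cos (\<i> * of_real u + of_real pi)"
    by (simp add: cosh_conv_cos cos_add)
  then obtain m :: real where "m \<in> \<int>" and m: "\<i> * z = \<i> * of_real u + of_real pi + of_real (2 * m * pi)
      \<or> \<i> * z = - (\<i> * of_real u + of_real pi) + of_real (2 * m * pi)"
    unfolding complex_cos_eq by blast
  then obtain n :: int where n: "m = of_int n"
    by (auto elim: Ints_cases)
  from m[unfolded n] show "z \<in> {Complex u pi, Complex (- u) pi}"
  proof
    assume "\<i> * z = \<i> * of_real u + of_real pi + of_real (2 * of_int n * pi)"
    hence z: "Re z = u" "- Im z = pi + 2 * of_int n * pi"
      by (simp_all add: complex_eq_iff)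
    have "pi * (1 + 2 * of_int n) = - Im z"
      unfolding z(2) by (simp add: algebra_simps)
    hence "pi * (-3) < pi * (1 + 2 * of_int n)" "pi * (1 + 2 * of_int n) < pi * 1"
      using assms by linarith+
    hence "-3 < 1 + 2 * real_of_int n" "1 + 2 * real_of_int n < 1"
      using mult_less_cancel_left_pos[OF pi_gt_zero] by (metis, metis)
    hence "n = - 1" by linarith
    thus ?thesis using z by (simp add: complex_eq_iff)
  next
    assume "\<i> * z = - (\<i> * of_real u + of_real pi) + of_real (2 * of_int n * pi)"
    hence z: "Re z = - u" "- Im z = - pi + 2 * of_int n * pi"
      by (simp_all add: complex_eq_iff)
    have "pi * (- 1 + 2 * of_int n) = - Im z"
      unfolding z(2) by (simp add: algebra_simps)
    hence "pi * (-3) < pi * (- 1 + 2 * of_int n)" "pi * (- 1 + 2 * of_int n) < pi * 1"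
      using assms by linarith+
    hence "-3 < - 1 + 2 * real_of_int n" "- 1 + 2 * real_of_int n < 1"
      using mult_less_cancel_left_pos[OF pi_gt_zero] by (metis, metis)
    hence "n = 0" by linarith
    thus ?thesis using z by (simp add: complex_eq_iff)
  qed
next
  assume "z \<in> {Complex u pi, Complex (- u) pi}"
  then obtain v where v: "z = Complex v pi" "v = u \<or> v = - u" by blast
  from v(2) have "cosh v = cosh u" by auto
  thus "of_real (cosh u) + cosh z = 0"
    unfolding v(1) by (simp add: complex_eq_iff Re_cosh_Complex Im_cosh_Complex)
qed

text \<open>The integrand is multiplied by \<open>exp (2 \<pi> \<i> \<mu>)\<close> under translation by \<open>2 \<pi> \<i>\<close>, and the strip in between
  contains the two simple poles \<open>\<pi> \<i> \<plusminus> u\<close>. Multiplying by the sine keeps the statement meaningful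
  at \<open>\<mu> = 0\<close>, where it is trivial.\<close>

lemma integral_exp_over_cosh_plus_cosh:
  fixes \<mu> :: complex and u :: real
  assumes \<mu>: "\<bar>Re \<mu>\<bar> < 1" and u: "u \<noteq> 0"
  shows "sin (of_real pi * \<mu>) * (LBINT t. exp (\<mu> * of_real t) / of_real (cosh u + cosh t))
     = 2 * of_real pi * sinh (\<mu> * of_real u) / of_real (sinh u)"
proof -
  define f where "f = (\<lambda>z. exp (\<mu> * z) / (of_real (cosh u) + cosh z))"
  \<comment> \<open>An open set around the closed strip of height \<open>2 \<pi>\<close>, small
    enough to contain no further poles.\<close>
  define S where "S = {z. - pi < Im z \<and> Im z < 3 * pi}"
  define P where "P = {Complex u pi, Complex (- u) pi}"
  define I where "I = (LBINT t. exp (\<mu> * of_real t) / of_real (cosh u + cosh t))"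
  have S: "open S" "convex S" "connected S"
  proof -
    have "S = {z. - pi < Im z} \<inter> {z. Im z < 3 * pi}" unfolding S_def by auto
    thus "open S" "convex S"
      by (auto intro!: open_Int convex_Int open_halfspace_Im_gt open_halfspace_Im_lt
          convex_halfspace_Im_gt convex_halfspace_Im_lt)
    thus "connected S" by (simp add: convex_connected)
  qed
  have strip: "z \<in> S" if "Im z \<in> {0..2 * pi}" for z
    using that unfolding S_def mem_Collect_eq atLeastAtMost_iff using pi_gt_zero by linarith
  have hol_num: "(\<lambda>z. exp (\<mu> * z)) holomorphic_on A" for A
    by (intro holomorphic_intros)
  have hol_den: "(\<lambda>z. complex_of_real (cosh u) + cosh z) holomorphic_on A" for A
    unfolding cosh_field_def[where 'a = complex] by (intro holomorphic_intros) auto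
  have zero: "of_real (cosh u) + cosh z = 0 \<longleftrightarrow> z \<in> P" if "z \<in> S" for z
    using cosh_eq_minus_cosh_strip[of z u] that unfolding S_def P_def by blast
  have holf: "f holomorphic_on S - P"
    unfolding f_def by (intro holomorphic_on_divide hol_num hol_den) (use zero in blast)
  have contf: "continuous_on A f" if "A \<subseteq> S - P" for A
    using that holf holomorphic_on_imp_continuous_on continuous_on_subset by blast
  have PS: "P \<subseteq> S" unfolding P_def S_def by auto
  \<comment> \<open>The derivative of the denominator is \<open>sinh\<close>, which at
    \<open>v + \<i> \<pi>\<close> equals \<open>- sinh v\<close>; it is nonzero as
    \<open>u \<noteq> 0\<close>, so the pole is simple.\<close>
  have residue: "residue f (Complex v pi) = - exp (\<mu> * Complex v pi) / of_real (sinh v)"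
    if "\<bar>v\<bar> = \<bar>u\<bar>" for v
  proof -
    have "Complex v pi \<in> P" using that unfolding P_def by (auto simp: abs_eq_iff)
    have "residue f (Complex v pi) = exp (\<mu> * Complex v pi) / sinh (Complex v pi)"
      unfolding f_def
    proof (rule residue_simple_pole_deriv[OF hol_num hol_den S(1,3)])
      show "Complex v pi \<in> S" "complex_of_real (cosh u) + cosh (Complex v pi) = 0"
        using \<open>Complex v pi \<in> P\<close> PS zero by auto
      show "((\<lambda>z. complex_of_real (cosh u) + cosh z) has_field_derivative sinh (Complex v pi)) (at (Complex v pi))"
        by (auto intro!: derivative_eq_intros)
    qed (use that u in \<open>auto simp: sinh_Complex_pi\<close>)
    thus ?thesis by (simp add: sinh_Complex_pi)
  qed
  have rect: "contour_integral (rectpath (Complex (- R) 0) (Complex R (2 * pi))) f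
      = 2 * of_real pi * \<i> * (\<Sum>p\<in>P. residue f p)" if R: "R > \<bar>u\<bar>" for R
  proof -
    let ?g = "rectpath (Complex (- R) 0) (Complex R (2 * pi))"
    have "P \<subseteq> box (Complex (- R) 0) (Complex R (2 * pi))"
      using R unfolding P_def by (auto simp: in_box_complex_iff)
    hence 1: "winding_number ?g p = 1" if "p \<in> P" for p
      using that by (intro winding_number_rectpath) auto
    have sub: "cbox (Complex (- R) 0) (Complex R (2 * pi)) \<subseteq> S"
      using strip by (auto simp: in_cbox_complex_iff)
    have "contour_integral ?g f = 2 * pi * \<i> * (\<Sum>p\<in>P. winding_number ?g p * residue f p)"
    proof (rule Residue_theorem[OF S(1,3) _ holf])
      show "path_image ?g \<subseteq> S - P"
        using path_image_rectpath_cbox_minus_box[of "Complex (- R) 0" "Complex R (2 * pi)"] sub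
          \<open>P \<subseteq> box _ _\<close> R by auto
      show "\<forall>z. z \<notin> S \<longrightarrow> winding_number ?g z = 0"
        using sub R by (auto intro!: winding_number_rectpath_outside)
    qed (auto simp: P_def)
    thus ?thesis using 1 by simp
  qed
  \<comment> \<open>As \<open>sinh\<close> is odd, the residues at the two poles carry opposite
    signs and their exponentials combine into a hyperbolic sine.\<close>
  have sum: "(\<Sum>p\<in>P. residue f p) = 2 * exp (\<mu> * \<i> * of_real pi) * (- sinh (\<mu> * of_real u) / of_real (sinh u))"
  proof -
    have "Complex v pi = of_real v + \<i> * of_real pi" for v by (simp add: complex_eq_iff)
    hence E: "exp (\<mu> * Complex v pi) = exp (\<mu> * \<i> * of_real pi) * exp (\<mu> * of_real v)" for v
      by (simp add: exp_add[symmetric] algebra_simps)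
    have "(\<Sum>p\<in>P. residue f p) = residue f (Complex u pi) + residue f (Complex (- u) pi)"
      using u unfolding P_def by simp
    also have "\<dots> = 2 * exp (\<mu> * \<i> * of_real pi) * (- sinh (\<mu> * of_real u) / of_real (sinh u))"
      using u by (simp add: residue E sinh_field_def[of "\<mu> * of_real u"] field_simps)
    finally show ?thesis .
  qed
  have f_line: "f (Complex t 0) = exp (\<mu> * of_real t) / of_real (cosh u + cosh t)"
    "f (Complex t (2 * pi)) = exp (2 * \<mu> * \<i> * of_real pi) * (exp (\<mu> * of_real t) / of_real (cosh u + cosh t))" for t
  proof -
    show "f (Complex t 0) = exp (\<mu> * of_real t) / of_real (cosh u + cosh t)"
      by (simp add: f_def complex_of_real_def[symmetric] cosh_of_real_complex)
    have "cosh (Complex t (2 * pi)) = of_real (cosh t)"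
      by (simp add: complex_eq_iff Re_cosh_Complex Im_cosh_Complex)
    moreover have "Complex t (2 * pi) = of_real t + 2 * \<i> * of_real pi" by (simp add: complex_eq_iff)
    ultimately show "f (Complex t (2 * pi)) = exp (2 * \<mu> * \<i> * of_real pi) * (exp (\<mu> * of_real t) / of_real (cosh u + cosh t))"
      by (simp add: f_def exp_add algebra_simps)
  qed
  have int: "integrable lborel (\<lambda>t. exp (\<mu> * of_real t) / of_real (cosh u + cosh t))"
    using integrable_exp_over_cosh[of "cosh u" 1 \<mu>] \<mu> by simp
  have pos: "cosh u + cosh t > 0" for t by (intro add_pos_pos) auto
  have cont: "continuous_on UNIV (\<lambda>t. exp (\<mu> * of_real t) / complex_of_real (cosh u + cosh t))"
    using less_imp_neq[OF pos] by (intro continuous_intros) (auto simp del: of_real_add)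
  define b where "b = 2 * pi * \<bar>Im \<mu>\<bar>"
  \<comment> \<open>Any \<open>a < 1\<close> above \<open>\<bar>Re \<mu>\<bar>\<close> would do; \<open>a > 0\<close> excludes the degenerate case in the limit of \<open>G\<close>.\<close>
  define a where "a = (1 + \<bar>Re \<mu>\<bar>) / 2"
  have a: "0 < a" "a < 1" "\<bar>Re \<mu>\<bar> \<le> a"
    using \<mu> by (auto simp: a_def)
  \<comment> \<open>Since \<open>|cosh z| \<ge> sinh R\<close> on both sides, the denominator is at
    least \<open>sinh R - cosh u\<close>, of order \<open>exp R\<close>, and \<open>a < 1\<close>
    gives decay.\<close>
  define G where "G = (\<lambda>R. exp (a * R + b) / (sinh R - cosh u))"
  have ev: "\<forall>\<^sub>F R in at_top. R > \<bar>u\<bar> \<and> sinh R > cosh u"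
    by (intro eventually_conj eventually_gt_at_top)
       (use filterlim_at_top_dense sinh_real_at_top in blast)
  have I_eq: "I - exp (2 * \<mu> * \<i> * of_real pi) * I
      = 2 * of_real pi * \<i> * (2 * exp (\<mu> * \<i> * of_real pi) * (- sinh (\<mu> * of_real u) / of_real (sinh u)))"
  proof -
    have "(LBINT t. f (Complex t 0)) - (LBINT t. f (Complex t (2 * pi)))
        = 2 * of_real pi * \<i> * (\<Sum>p\<in>P. residue f p)"
    proof (rule integral_strip_difference[where G = G])
      show "\<forall>\<^sub>F R in at_top. contour_integral (rectpath (Complex (- R) 0) (Complex R (2 * pi))) f
          = 2 * of_real pi * \<i> * (\<Sum>p\<in>P. residue f p)"
        by (rule eventually_mono[OF eventually_gt_at_top[of "\<bar>u\<bar>"] rect])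
      show "\<forall>\<^sub>F R in at_top. continuous_on {z. \<bar>Re z\<bar> = R \<and> Im z \<in> {0..2 * pi}} f"
      proof (rule eventually_mono[OF eventually_gt_at_top[of "\<bar>u\<bar>"]])
        fix R assume "R > \<bar>u\<bar>"
        thus "continuous_on {z. \<bar>Re z\<bar> = R \<and> Im z \<in> {0..2 * pi}} f"
          by (intro contf) (use strip in \<open>auto simp: P_def\<close>)
      qed
      show "\<forall>\<^sub>F R in at_top. \<forall>z. \<bar>Re z\<bar> = R \<longrightarrow> Im z \<in> {0..2 * pi} \<longrightarrow> norm (f z) \<le> G R"
        using ev
      proof (rule eventually_mono, intro allI impI)
        fix R z assume R: "R > \<bar>u\<bar> \<and> sinh R > cosh u" and z: "\<bar>Re z\<bar> = R" "Im z \<in> {0..2 * pi}"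
        have "Re \<mu> * Re z \<le> a * R"
          using mult_le_mult_abs[OF a(3), of "Re z"] z by simp
        moreover have "- (Im \<mu> * Im z) \<le> b"
        proof -
          have "- (Im \<mu> * Im z) \<le> \<bar>Im \<mu>\<bar> * \<bar>Im z\<bar>"
            using mult_le_mult_abs[of "- Im \<mu>" "\<bar>Im \<mu>\<bar>" "Im z"] by simp
          also have "\<dots> \<le> \<bar>Im \<mu>\<bar> * (2 * pi)" using z by (intro mult_left_mono) auto
          finally show ?thesis by (simp add: b_def mult_ac)
        qed
        ultimately have num: "norm (exp (\<mu> * z)) \<le> exp (a * R + b)" by simp
        have "sinh R \<le> norm (cosh z)"
        proof -
          \<comment> \<open>Which of the two exponentials dominates depends on the sign of
            \<open>Re z\<close>, hence two instances of the reverse triangle inequality.\<close>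
          have "exp R / 2 - exp (- R) / 2 \<le> norm (exp z / 2 + exp (- z) / 2)"
            using norm_diff_ineq[of "exp z / 2" "exp (- z) / 2"]
              norm_diff_ineq[of "exp (- z) / 2" "exp z / 2"] z(1)
            by (auto simp: abs_if norm_divide add.commute split: if_splits)
          thus ?thesis by (simp add: sinh_field_def cosh_field_def add_divide_distrib diff_divide_distrib)
        qed
        hence den: "sinh R - cosh u \<le> norm (of_real (cosh u) + cosh z)"
          using norm_diff_ineq[of "cosh z" "of_real (cosh u)"] by (simp add: add.commute)
        show "norm (f z) \<le> G R"
          unfolding f_def G_def norm_divide using R num den by (intro frac_le) auto
      qed
      show "(G \<longlongrightarrow> 0) at_top"
      proof -
        define C where "C = cosh u"
        have "((\<lambda>R. exp (a * R + b) / ((exp R - exp (- R)) / 2 - C)) \<longlongrightarrow> 0) at_top"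
          using a by real_asymp
        also have "(\<lambda>R. exp (a * R + b) / ((exp R - exp (- R)) / 2 - C)) = G"
          unfolding G_def C_def sinh_field_def[where 'a = real] by simp
        finally show ?thesis .
      qed
      show "continuous_on UNIV (\<lambda>t. f (Complex t 0))" "continuous_on UNIV (\<lambda>t. f (Complex t (2 * pi)))"
        unfolding f_line by (intro cont continuous_on_mult_left)+
      show "integrable lborel (\<lambda>t. f (Complex t 0))" "integrable lborel (\<lambda>t. f (Complex t (2 * pi)))"
        unfolding f_line by (intro int integrable_mult_right)+
    qed simp
    thus ?thesis unfolding f_line sum I_def integral_mult_right_zero .
  qed
  \<comment> \<open>The identity \<open>1 - E^2 = - 2 \<i> E sin (\<pi> \<mu>)\<close> turns the
    relation for \<open>I\<close> into the claim, the factor \<open>E\<close> cancelling.\<close>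
  define E where "E = exp (\<mu> * \<i> * of_real pi)"
  have "E \<noteq> 0" by (simp add: E_def)
  have EE: "exp (2 * \<mu> * \<i> * of_real pi) = E * E"
    by (simp add: E_def exp_add[symmetric] mult_ac)
  have sin: "sin (of_real pi * \<mu>) = (E - inverse E) / (2 * \<i>)"
    by (simp add: E_def sin_exp_eq exp_minus mult_ac)
  have *: "(1 - E * E) * I = 2 * of_real pi * \<i> * (2 * E * (- sinh (\<mu> * of_real u) / of_real (sinh u)))"
    using I_eq unfolding EE E_def[symmetric] by (simp add: left_diff_distrib)
  have "sin (of_real pi * \<mu>) * I = - ((1 - E * E) * I) / (2 * \<i> * E)"
    using \<open>E \<noteq> 0\<close> unfolding sin by (simp add: field_simps)
  also have "\<dots> = 2 * of_real pi * sinh (\<mu> * of_real u) / of_real (sinh u)"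
    unfolding * using \<open>E \<noteq> 0\<close> by (simp add: field_simps)
  finally show ?thesis unfolding I_def .
qed

text \<open>At \<open>\<mu> = 0\<close> the sine identity reads \<open>0 = 0\<close>, so the
  exceptional term is found from an elementary antiderivative.\<close>

lemma integral_inverse_cosh_plus_cosh:
  fixes u :: real
  assumes "u \<noteq> 0"
  shows "(LBINT t. 1 / (cosh u + cosh t)) = 2 * u / sinh u"
proof -
  \<comment> \<open>Comes from \<open>sinh u / (cosh u + cosh t) = (tanh ((t + u) / 2) - tanh ((t -
    u) / 2)) / 2\<close>.\<close>
  define F where "F = (\<lambda>t. (ln (cosh ((t + u) / 2)) - ln (cosh ((t - u) / 2))) / sinh u)"
  have pos: "cosh u + cosh t > 0" for t by (intro add_pos_pos) auto
  have F_eq: "F = (\<lambda>t. (ln ((exp ((t + u) / 2) + exp (- ((t + u) / 2))) / 2)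
      - ln ((exp ((t - u) / 2) + exp (- ((t - u) / 2))) / 2)) / sinh u)"
    unfolding F_def cosh_field_def ..
  have "(LBINT t=-\<infinity>..\<infinity>. 1 / (cosh u + cosh t)) = u / sinh u - (- u / sinh u)"
  proof (rule interval_integral_FTC_nonneg(2))
    show "DERIV F t :> 1 / (cosh u + cosh t)" for t
    proof -
      let ?A = "cosh ((t + u) / 2)" and ?B = "cosh ((t - u) / 2)"
      have "(t + u) / 2 - (t - u) / 2 = u" "(t + u) / 2 + (t - u) / 2 = t" by (simp_all add: field_simps)
      hence diff: "sinh ((t + u) / 2) * ?B - ?A * sinh ((t - u) / 2) = sinh u"
        and prod: "2 * (?A * ?B) = cosh u + cosh t"
        using sinh_diff[of "(t + u) / 2" "(t - u) / 2"] cosh_diff[of "(t + u) / 2" "(t - u) / 2"]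
          cosh_add[of "(t + u) / 2" "(t - u) / 2"] by simp_all
      have "DERIV F t :> (sinh ((t + u) / 2) / 2 / ?A - sinh ((t - u) / 2) / 2 / ?B) / sinh u"
        unfolding F_def using assms by (auto intro!: derivative_eq_intros)
      also have "(sinh ((t + u) / 2) / 2 / ?A - sinh ((t - u) / 2) / 2 / ?B)
          = (sinh ((t + u) / 2) * ?B - ?A * sinh ((t - u) / 2)) / (2 * (?A * ?B))"
        by (simp add: divide_simps)
      finally show ?thesis unfolding diff prod using assms by simp
    qed
    show "isCont (\<lambda>t. 1 / (cosh u + cosh t)) t" for t
      using less_imp_neq[OF pos[of t]] by (intro continuous_intros) auto
    \<comment> \<open>For large \<open>t\<close>, \<open>ln (cosh ((t \<plusminus> u) / 2))\<close>
      is \<open>(t \<plusminus> u) / 2 - ln 2\<close> up to a vanishing error.\<close>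
    have num: "((\<lambda>t. ln ((exp ((t + u) / 2) + exp (- ((t + u) / 2))) / 2)
        - ln ((exp ((t - u) / 2) + exp (- ((t - u) / 2))) / 2)) \<longlongrightarrow> u) at_top"
      by (real_asymp simp: ln_div)
    have "((\<lambda>t. ln ((exp ((t + u) / 2) + exp (- ((t + u) / 2))) / 2)
        - ln ((exp ((t - u) / 2) + exp (- ((t - u) / 2))) / 2)) \<longlongrightarrow> - u) at_bot"
      by (real_asymp simp: ln_div)
    thus "((F \<circ> real_of_ereal) \<longlongrightarrow> - u / sinh u) (at_right (- \<infinity>))"
      unfolding ereal_tendsto_simps F_eq by (rule tendsto_divide) (use assms in auto)
    show "((F \<circ> real_of_ereal) \<longlongrightarrow> u / sinh u) (at_left \<infinity>)"
      unfolding ereal_tendsto_simps F_eq by (rule tendsto_divide[OF num]) (use assms in auto)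
    show "AE t in lborel. - \<infinity> < ereal t \<longrightarrow> ereal t < \<infinity> \<longrightarrow> 0 \<le> 1 / (cosh u + cosh t)"
      using pos by (simp add: less_imp_le)
  qed simp
  thus ?thesis
    by (simp add: interval_lebesgue_integral_def einterval_def set_lebesgue_integral_def)
qed

text \<open>With \<open>S = sin (\<pi> \<mu>)\<close> and \<open>w = sinh (\<mu> u)\<close>, the
  sine identity gives \<open>V = (\<pi> / sinh u) (w / S)\<close>. Rationalising by the conjugate of
  \<open>S\<close> produces the denominator \<open>D = |S|^2\<close>.\<close>

lemma
  fixes \<alpha> u :: real and n :: nat
  assumes \<alpha>: "\<bar>\<alpha>\<bar> < 1" and u: "u \<noteq> 0" and ne: "\<alpha> \<noteq> 0 \<or> n \<noteq> 0"
  defines "V \<equiv> (LBINT t. exp (Complex \<alpha> (real n) * of_real t) / of_real (cosh u + cosh t)) / 2"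
    and "D \<equiv> (sinh (pi * real n))\<^sup>2 + (sin (pi * \<alpha>))\<^sup>2"
  shows Re_integral_exp_over_cosh:
      "Re V = pi / sinh u * ((sinh (\<alpha> * u) * sin (\<alpha> * pi) * cosh (pi * real n) * cos (real n * u)
          + cosh (\<alpha> * u) * cos (\<alpha> * pi) * sinh (pi * real n) * sin (real n * u)) / D)" (is ?R)
    and Im_integral_exp_over_cosh:
      "Im V = pi / sinh u * ((cosh (\<alpha> * u) * sin (\<alpha> * pi) * cosh (pi * real n) * sin (real n * u)
          - sinh (\<alpha> * u) * cos (\<alpha> * pi) * sinh (pi * real n) * cos (real n * u)) / D)" (is ?I)
proof -
  define S where "S = sin (of_real pi * Complex \<alpha> (real n))"
  define w where "w = sinh (Complex \<alpha> (real n) * of_real u)"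
  have Re_S: "Re S = sin (\<alpha> * pi) * cosh (pi * real n)" and Im_S: "Im S = cos (\<alpha> * pi) * sinh (pi * real n)"
    by (simp_all add: S_def Re_sin Im_sin cosh_field_def sinh_field_def mult.commute)
  have Re_w: "Re w = sinh (\<alpha> * u) * cos (real n * u)" and Im_w: "Im w = cosh (\<alpha> * u) * sin (real n * u)"
    by (simp_all add: w_def cosh_field_def sinh_field_def Re_exp Im_exp algebra_simps
        add_divide_distrib diff_divide_distrib)
  have D_eq: "(Re S)\<^sup>2 + (Im S)\<^sup>2 = D"
    unfolding Re_S Im_S D_def power_mult_distrib cosh_square_eq cos_squared_eq
    by (simp add: algebra_simps)
  \<comment> \<open>For \<open>|\<alpha>| < 1\<close> the sine vanishes only at
    \<open>\<alpha> = 0\<close>, and \<open>sinh (\<pi> n)\<close> only at \<open>n = 0\<close>;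
    \<open>ne\<close> excludes that both happen.\<close>
  have "D \<noteq> 0"
  proof
    assume "D = 0"
    hence "sinh (pi * real n) = 0" "sin (pi * \<alpha>) = 0"
      unfolding D_def by (simp_all add: sum_power2_eq_zero_iff)
    moreover have "- pi < pi * \<alpha>" "pi * \<alpha> < pi"
      using mult_strict_left_mono[of "- 1" \<alpha> pi] mult_strict_left_mono[of \<alpha> 1 pi] \<alpha> by auto
    ultimately have "n = 0" "\<alpha> = 0"
      using sin_eq_0_pi[of "pi * \<alpha>"] by auto
    thus False using ne by simp
  qed
  hence "S \<noteq> 0" using D_eq by auto
  hence "V = of_real (pi / sinh u) * (w / S)"
    using integral_exp_over_cosh_plus_cosh[of "Complex \<alpha> (real n)" u] \<alpha> u
    by (simp add: V_def S_def w_def field_simps)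
  hence "Re V = pi / sinh u * Re (w / S)" "Im V = pi / sinh u * Im (w / S)"
    by (simp_all only: Re_complex_of_real Im_complex_of_real times_complex.sel)
  thus ?R ?I
    unfolding Re_divide Im_divide Re_S Im_S Re_w Im_w D_eq[unfolded Re_S Im_S] by (simp_all add: mult_ac)
qed

text \<open>The value \<open>u / sinh u\<close> is split so that the factor
  \<open>\<pi> / sinh u\<close> common to all terms stands apart, leaving the limit
  \<open>u / \<pi>\<close>.\<close>

lemma Re_integral_inverse_cosh_plus_cosh:
  assumes "u \<noteq> 0"
  shows "Re ((LBINT t. exp (Complex 0 0 * of_real t) / of_real (cosh u + cosh t)) / 2) = pi / sinh u * (u / pi)"
proof -
  have "(LBINT t. exp (Complex 0 0 * of_real t) / of_real (cosh u + cosh t))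
      = (LBINT t. complex_of_real (1 / (cosh u + cosh t)))"
    by (simp add: Complex_eq)
  also have "\<dots> = of_real (2 * u / sinh u)"
    unfolding integral_complex_of_real integral_inverse_cosh_plus_cosh[OF assms] ..
  finally show ?thesis by simp
qed

subsection \<open>Termwise integration of the series\<close>

text \<open>\<open>L\<close> stands for \<open>Re\<close> or \<open>Im\<close>, so both claims are
  treated at once: being linear and bounded it commutes with the integral, and being
  norm-nonincreasing it keeps the bound on \<open>MK\<close>.\<close>

lemma laplace_series:
  fixes L :: "complex \<Rightarrow> real" and a :: "nat \<Rightarrow> complex"
  assumes L: "bounded_linear L" "\<And>z. \<bar>L z\<bar> \<le> norm z"
    and \<alpha>: "\<bar>\<alpha>\<bar> < 1"
    and \<delta>: "0 < \<delta>" "\<delta> < pi / 2"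
    and summable: "summable (\<lambda>n. norm (a n) * exp (- \<delta> * real n))"
  defines "k \<equiv> \<lambda>n x. a n * complex_of_real (L (MK (Complex \<alpha> (real n)) x))"
    and "V \<equiv> \<lambda>u n. a n * complex_of_real (L ((LBINT t. exp (Complex \<alpha> (real n) * of_real t) / of_real (cosh u + cosh t)) / 2))"
  shows summable_MK_series: "\<And>x. x > 0 \<Longrightarrow> summable (\<lambda>n. norm (k n x))"
    and integrable_laplace_MK_series: "set_integrable lborel {0<..} (\<lambda>x. exp (- x * cosh u) *\<^sub>R (\<Sum>n. k n x))"
    and summable_laplace_MK_series: "summable (\<lambda>n. norm (V u n))"
    and laplace_MK_series: "(LINT x:{0<..}|lborel. exp (- x * cosh u) *\<^sub>R (\<Sum>n. k n x)) = (\<Sum>n. V u n)"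
proof -
  have cos: "cos \<delta> > 0" using \<delta> by (intro cos_gt_zero_pi) auto
  define B where "B = (\<lambda>n. norm (a n) * exp (- \<delta> * real n))"
  have k_bound: "norm (k n x) \<le> B n * norm (MK (of_real \<alpha>) (cos \<delta> * x))" if "x > 0" for n x
  proof -
    have "norm (k n x) \<le> norm (a n) * norm (MK (Complex \<alpha> (real n)) x)"
      unfolding k_def norm_mult norm_of_real by (intro mult_left_mono L) auto
    also have "\<dots> \<le> norm (a n) * (exp (- \<delta> * real n) * norm (MK (of_real \<alpha>) (cos \<delta> * x)))"
      using norm_MK_le[OF that \<delta>, of "Complex \<alpha> (real n)"] by (intro mult_left_mono) auto
    finally show ?thesis by (simp add: B_def mult.assoc)
  qed
  show sum_k: "summable (\<lambda>n. norm (k n x))" if "x > 0" for x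
    by (rule summable_comparison_test'[OF summable_mult2[OF summable[folded B_def]]])
       (use k_bound[OF that] in auto)
  \<comment> \<open>One integrable function of \<open>x\<close> for the whole series; the dependence
    on \<open>n\<close> sits in the summable factor \<open>B n\<close>.\<close>
  define h where "h = (\<lambda>x. indicator {0<..} x * (exp (- x * cosh u) * norm (MK (of_real \<alpha>) (cos \<delta> * x))))"
  have h: "integrable lborel h"
    using integrable_norm[OF integrable_laplace_MK[of "cosh u" "cos \<delta>" "of_real \<alpha>", unfolded set_integrable_def]] cos \<alpha>
    by (simp add: h_def mult.assoc)
  \<comment> \<open>Coefficient and \<open>L\<close> together form one real-linear bounded map, so
    the integral of each term comes from that of \<open>m n\<close>.\<close>
  define T where "T = (\<lambda>n z. a n * complex_of_real (L z))"
  define m where "m = (\<lambda>n x. indicator {0<..} x *\<^sub>R (exp (- x * cosh u) *\<^sub>R MK (Complex \<alpha> (real n)) (1 * x)))"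
  define g where "g = (\<lambda>n x. indicator {0<..} x *\<^sub>R (exp (- x * cosh u) *\<^sub>R k n x))"
  have T: "bounded_linear (T n)" for n
    unfolding T_def
    by (intro bounded_linear_compose[OF bounded_linear_mult_right] bounded_linear_compose[OF bounded_linear_of_real] L)
  have m: "integrable lborel (m n)" for n
    using integrable_laplace_MK[of "cosh u" 1 "Complex \<alpha> (real n)"] \<alpha> by (simp add: m_def set_integrable_def)
  have Tm: "T n (m n x) = g n x" for n x
    unfolding m_def g_def by (simp add: linear_cmul[OF bounded_linear.linear[OF T]]) (simp add: T_def k_def)
  have g: "integrable lborel (g n)" for n
    using integrable_bounded_linear[OF T m, of n n] by (simp add: Tm)
  have int_g: "integral\<^sup>L lborel (g n) = V u n" for n
  proof -
    have "integral\<^sup>L lborel (g n) = T n (integral\<^sup>L lborel (m n))"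
      using integral_bounded_linear[OF T m, of n n] by (simp add: Tm)
    also have "integral\<^sup>L lborel (m n) = (LBINT t. exp (Complex \<alpha> (real n) * of_real t) / of_real (cosh u + cosh t)) / 2"
      using laplace_MK[of "cosh u" 1 "Complex \<alpha> (real n)"] \<alpha>
      by (simp add: m_def set_lebesgue_integral_def)
    finally show ?thesis by (simp add: T_def V_def)
  qed
  have g_bound: "norm (g n x) \<le> B n * h x" for n x
    using mult_left_mono[OF k_bound[of x n], of "exp (- x * cosh u)"]
    by (auto simp: g_def h_def indicator_def mult_ac)
  have sum_g: "summable (\<lambda>n. norm (g n x))" for x
    by (rule summable_comparison_test'[OF summable_mult2[OF summable[folded B_def], of "h x"]])
       (use g_bound in auto)
  have int_norm: "(LBINT x. norm (g n x)) \<le> B n * integral\<^sup>L lborel h" for n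
    unfolding integral_mult_right_zero[symmetric]
    by (intro integral_mono integrable_norm g integrable_mult_right h g_bound)
  \<comment> \<open>Summability of the \<open>L^1\<close> norms is the condition that permits
    exchanging sum and integral.\<close>
  have sum_int: "summable (\<lambda>n. LBINT x. norm (g n x))"
    by (rule summable_comparison_test'[OF summable_mult2[OF summable[folded B_def]]])
       (use int_norm in \<open>auto simp: integral_nonneg_AE\<close>)
  have sum_eq: "(\<Sum>n. g n x) = indicator {0<..} x *\<^sub>R (exp (- x * cosh u) *\<^sub>R (\<Sum>n. k n x))" for x
    unfolding g_def using summable_norm_cancel[OF sum_k[of x]]
    by (cases "x > 0") (simp_all add: suminf_scaleR_right)
  show "set_integrable lborel {0<..} (\<lambda>x. exp (- x * cosh u) *\<^sub>R (\<Sum>n. k n x))"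
    using integrable_suminf[OF g _ sum_int] sum_g by (simp add: sum_eq set_integrable_def)
  show "(LINT x:{0<..}|lborel. exp (- x * cosh u) *\<^sub>R (\<Sum>n. k n x)) = (\<Sum>n. V u n)"
    using integral_suminf[OF g _ sum_int] sum_g by (simp add: sum_eq int_g set_lebesgue_integral_def)
  \<comment> \<open>Each \<open>V u n\<close> is the integral of \<open>g n\<close>, hence bounded
    by its \<open>L^1\<close> norm.\<close>
  show "summable (\<lambda>n. norm (V u n))"
    by (rule summable_comparison_test'[OF sum_int, of 0]) (simp add: int_g[symmetric])
qed

section \<open>The two claims as instances of the series lemma\<close>

theorem theorem1:
  fixes \<alpha> :: real and a :: "nat \<Rightarrow> complex"
  assumes "\<bar>\<alpha>\<bar> < 1"
    and "\<exists>\<delta>. 0 \<le> \<delta> \<and> \<delta> < pi / 2 \<and> summable (\<lambda>n. norm (a n) * exp (- \<delta> * real n))"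
  shows
   "(let f = (\<lambda>x. \<Sum>n. a n * complex_of_real (ReK \<alpha> (real n) x));
         c = (\<lambda>u n. if \<alpha> = 0 \<and> n = 0 then a 0 * complex_of_real (u / pi)
                    else a n * complex_of_real
                      ((sinh (\<alpha> * u) * sin (\<alpha> * pi) * cosh (pi * real n) * cos (real n * u)
                        + cosh (\<alpha> * u) * cos (\<alpha> * pi) * sinh (pi * real n) * sin (real n * u))
                       / ((sinh (pi * real n))\<^sup>2 + (sin (pi * \<alpha>))\<^sup>2)))
     in (\<forall>x>0. summable (\<lambda>n. norm (a n * complex_of_real (ReK \<alpha> (real n) x)))) \<and>
        (\<forall>u. u \<noteq> 0 \<longrightarrow>
           set_integrable lborel {0<..} (\<lambda>x. exp (- x * cosh u) *\<^sub>R f x) \<and>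
           summable (\<lambda>n. norm (c u n)) \<and>
           (LINT x:{0<..}|lborel. exp (- x * cosh u) *\<^sub>R f x)
             = complex_of_real (pi / sinh u) * (\<Sum>n. c u n)))
    \<and>
    (a 0 = 0 \<longrightarrow>
     (let f = (\<lambda>x. \<Sum>n. a n * complex_of_real (ImK \<alpha> (real n) x));
          c = (\<lambda>u n. a n * complex_of_real
                      ((cosh (\<alpha> * u) * sin (\<alpha> * pi) * cosh (pi * real n) * sin (real n * u)
                        - sinh (\<alpha> * u) * cos (\<alpha> * pi) * sinh (pi * real n) * cos (real n * u))
                       / ((sinh (pi * real n))\<^sup>2 + (sin (pi * \<alpha>))\<^sup>2)))
      in (\<forall>x>0. summable (\<lambda>n. norm (a n * complex_of_real (ImK \<alpha> (real n) x)))) \<and>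
         (\<forall>u. u \<noteq> 0 \<longrightarrow>
            set_integrable lborel {0<..} (\<lambda>x. exp (- x * cosh u) *\<^sub>R f x) \<and>
            summable (\<lambda>n. norm (c u (Suc n))) \<and>
            (LINT x:{0<..}|lborel. exp (- x * cosh u) *\<^sub>R f x)
              = complex_of_real (pi / sinh u) * (\<Sum>n. c u (Suc n)))))"
proof -
  obtain \<delta>0 where \<delta>0: "0 \<le> \<delta>0" "\<delta>0 < pi / 2" "summable (\<lambda>n. norm (a n) * exp (- \<delta>0 * real n))"
    using assms(2) by blast
  \<comment> \<open>The contour shift needs a strip of positive height, so \<open>\<delta> = 0\<close> is replaced by a larger value.\<close>
  define \<delta> where "\<delta> = (\<delta>0 + pi / 2) / 2"
  have \<delta>: "0 < \<delta>" "\<delta> < pi / 2" "\<delta>0 \<le> \<delta>"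
    using \<delta>0 pi_gt_zero unfolding \<delta>_def by (simp_all add: field_simps)
  have sum: "summable (\<lambda>n. norm (a n) * exp (- \<delta> * real n))"
    by (rule summable_comparison_test'[OF \<delta>0(3), of 0])
       (use \<delta> in \<open>auto intro!: mult_left_mono mult_right_mono\<close>)
  note series = laplace_series[OF _ _ assms(1) \<delta>(1,2) sum]
  \<comment> \<open>Common form of both claims: \<open>K\<close> is the chosen part of
    \<open>MK\<close>, and \<open>c\<close> are the coefficients after \<open>\<pi> / sinh u\<close>
    has been taken out.\<close>
  have transfer: "(\<forall>x>0. summable (\<lambda>n. norm (a n * complex_of_real (K (real n) x)))) \<and>
      (\<forall>u. u \<noteq> 0 \<longrightarrow>
         set_integrable lborel {0<..} (\<lambda>x. exp (- x * cosh u) *\<^sub>R (\<Sum>n. a n * complex_of_real (K (real n) x))) \<and>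
         summable (\<lambda>n. norm (c u n)) \<and>
         (LINT x:{0<..}|lborel. exp (- x * cosh u) *\<^sub>R (\<Sum>n. a n * complex_of_real (K (real n) x)))
           = complex_of_real (pi / sinh u) * (\<Sum>n. c u n))"
    if L: "bounded_linear L" "\<And>z. \<bar>L z\<bar> \<le> norm z"
      and K: "\<And>\<tau> x. x > 0 \<Longrightarrow> L (MK (Complex \<alpha> \<tau>) x) = K \<tau> x"
      and c: "\<And>u n. u \<noteq> 0 \<Longrightarrow> a n * complex_of_real (L ((LBINT t. exp (Complex \<alpha> (real n) * of_real t)
          / of_real (cosh u + cosh t)) / 2)) = complex_of_real (pi / sinh u) * c u n"
    for L :: "complex \<Rightarrow> real" and K :: "real \<Rightarrow> real \<Rightarrow> real" and c :: "real \<Rightarrow> nat \<Rightarrow> complex"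
  proof (intro conjI allI impI)
    show "summable (\<lambda>n. norm (a n * complex_of_real (K (real n) x)))" if "x > 0" for x
      using series(1)[OF L that] K[OF that] by simp
    fix u :: real assume u: "u \<noteq> 0"
    show "set_integrable lborel {0<..} (\<lambda>x. exp (- x * cosh u) *\<^sub>R (\<Sum>n. a n * complex_of_real (K (real n) x)))"
      using series(2)[OF L, of u] by (rule set_integrable_cong[THEN iffD1, rotated -1]) (simp_all add: K)
    have "summable (\<lambda>n. norm (complex_of_real (pi / sinh u) * c u n))"
      using series(3)[OF L, of u] unfolding c[OF u] .
    \<comment> \<open>The constant \<open>\<pi> / sinh u\<close> is nonzero and can be
      cancelled.\<close>
    hence sc: "summable (\<lambda>n. norm (c u n))"
      using u unfolding norm_mult by (subst (asm) summable_cmult_iff) auto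
    thus "summable (\<lambda>n. norm (c u n))" .
    have "(LINT x:{0<..}|lborel. exp (- x * cosh u) *\<^sub>R (\<Sum>n. a n * complex_of_real (K (real n) x)))
        = (LINT x:{0<..}|lborel. exp (- x * cosh u) *\<^sub>R (\<Sum>n. a n * complex_of_real (L (MK (Complex \<alpha> (real n)) x))))"
      by (rule set_lebesgue_integral_cong) (auto simp: K)
    also have "\<dots> = (\<Sum>n. complex_of_real (pi / sinh u) * c u n)"
      using series(4)[OF L, of u] unfolding c[OF u] .
    also have "\<dots> = complex_of_real (pi / sinh u) * (\<Sum>n. c u n)"
      by (rule suminf_mult[OF summable_norm_cancel[OF sc]])
    finally show "(LINT x:{0<..}|lborel. exp (- x * cosh u) *\<^sub>R (\<Sum>n. a n * complex_of_real (K (real n) x)))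
        = complex_of_real (pi / sinh u) * (\<Sum>n. c u n)" .
  qed
  show ?thesis
    unfolding Let_def
  proof (intro conjI[of "_ \<and> _"] impI, goal_cases)
    case 1
    show ?case
    proof (rule transfer[where L = Re])
      show "bounded_linear Re" by (rule bounded_linear_Re)
      show "\<bar>Re z\<bar> \<le> norm z" for z by (rule abs_Re_le_cmod)
      show "Re (MK (Complex \<alpha> \<tau>) x) = ReK \<alpha> \<tau> x" if "x > 0" for \<tau> x by (rule Re_MK[OF that])
    next
      fix u :: real and n assume u: "u \<noteq> 0"
      show "a n * complex_of_real (Re ((LBINT t. exp (Complex \<alpha> (real n) * of_real t) / of_real (cosh u + cosh t)) / 2))
        = complex_of_real (pi / sinh u) *
          (if \<alpha> = 0 \<and> n = 0 then a 0 * complex_of_real (u / pi)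
           else a n * complex_of_real
             ((sinh (\<alpha> * u) * sin (\<alpha> * pi) * cosh (pi * real n) * cos (real n * u)
               + cosh (\<alpha> * u) * cos (\<alpha> * pi) * sinh (pi * real n) * sin (real n * u))
              / ((sinh (pi * real n))\<^sup>2 + (sin (pi * \<alpha>))\<^sup>2)))"
      proof (cases "\<alpha> = 0 \<and> n = 0")
        case True
        thus ?thesis
          using Re_integral_inverse_cosh_plus_cosh[OF u] by (simp only: of_nat_0 of_real_mult simp_thms if_True mult_ac)
      next
        case False
        hence "\<alpha> \<noteq> 0 \<or> n \<noteq> 0" by blast
        from Re_integral_exp_over_cosh[OF assms(1) u this] False show ?thesis
          by (simp only: of_real_mult if_False mult_ac)
      qed
    qed
  next
    case 2
    let ?c = "\<lambda>u n. a n * complex_of_real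
                      ((cosh (\<alpha> * u) * sin (\<alpha> * pi) * cosh (pi * real n) * sin (real n * u)
                        - sinh (\<alpha> * u) * cos (\<alpha> * pi) * sinh (pi * real n) * cos (real n * u))
                       / ((sinh (pi * real n))\<^sup>2 + (sin (pi * \<alpha>))\<^sup>2))"
    have *: "(\<forall>x>0. summable (\<lambda>n. norm (a n * complex_of_real (ImK \<alpha> (real n) x)))) \<and>
      (\<forall>u. u \<noteq> 0 \<longrightarrow>
         set_integrable lborel {0<..} (\<lambda>x. exp (- x * cosh u) *\<^sub>R (\<Sum>n. a n * complex_of_real (ImK \<alpha> (real n) x))) \<and>
         summable (\<lambda>n. norm (?c u n)) \<and>
         (LINT x:{0<..}|lborel. exp (- x * cosh u) *\<^sub>R (\<Sum>n. a n * complex_of_real (ImK \<alpha> (real n) x)))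
           = complex_of_real (pi / sinh u) * (\<Sum>n. ?c u n))"
    proof (rule transfer[where L = Im])
      show "bounded_linear Im" by (rule bounded_linear_Im)
      show "\<bar>Im z\<bar> \<le> norm z" for z by (rule abs_Im_le_cmod)
      show "Im (MK (Complex \<alpha> \<tau>) x) = ImK \<alpha> \<tau> x" if "x > 0" for \<tau> x by (rule Im_MK[OF that])
    next
      fix u :: real and n assume u: "u \<noteq> 0"
      show "a n * complex_of_real (Im ((LBINT t. exp (Complex \<alpha> (real n) * of_real t) / of_real (cosh u + cosh t)) / 2))
        = complex_of_real (pi / sinh u) * ?c u n"
      \<comment> \<open>For \<open>n = 0\<close> both sides vanish through \<open>a 0 = 0\<close>,
        which also disposes of the degenerate case \<open>\<alpha> = 0\<close>.\<close>
      proof (cases "n = 0")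
        case True
        thus ?thesis using 2 by simp
      next
        case False
        hence "\<alpha> \<noteq> 0 \<or> n \<noteq> 0" by blast
        from Im_integral_exp_over_cosh[OF assms(1) u this] show ?thesis
          by (simp only: of_real_mult mult_ac)
      qed
    qed
    \<comment> \<open>The claim sums from \<open>n = 1\<close>; dropping the zero term at
      \<open>n = 0\<close> changes neither convergence nor value.\<close>
    have shift: "summable (\<lambda>n. norm (g (Suc n))) \<and> (\<Sum>n. g (Suc n)) = (\<Sum>n. g n)"
      if "summable (\<lambda>n. norm (g n))" "g 0 = 0" for g :: "nat \<Rightarrow> complex"
      using suminf_split_head[OF summable_norm_cancel[OF that(1)]] that
      by (simp add: summable_Suc_iff[of "\<lambda>n. norm (g n)"])
    have "?c u 0 = 0" for u using 2 by simp
    with * shift[of "?c _"] show ?case by simp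
  qed
qed

end
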